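(* Let $(A,\mu,\alpha)$ be a Hom-associative algebra and $r\in A^{\otimes 2}$ be an $\alpha$-invariant $2$-tensor. Define $\Delta=[-,r]_*\colon A\to A^{\otimes 2}$. Then $(A,\mu,\Delta,\alpha,r)$ is a coboundary $\epsilon$-Hom-bialgebra if and only if $A(r)\in A^{\otimes 3}$ is $A$-invariant.
   Context: Throughout, $\mathbf{k}$ is a fixed field of characteristic $0$; vector spaces, linear maps and tensor products are over $\mathbf{k}$. A Hom-associative algebra $(A,\mu,\alpha)$ is a $\mathbf{k}$-vector space $A$ with a bilinear map $\mu\colon A^{\otimes 2}\to A$ and a linear map $\alpha\colon A\to A$ such that $\alpha\circ\mu=\mu\circ\alpha^{\otimes 2}$ and $\mu\circ(\alpha\otimes\mu)=\mu\circ(\mu\otimes\alpha)$. An $\epsilon$-Hom-bialgebra $(A,\mu,\Delta,\alpha)$ is a Hom-associative algebra $(A,\mu,\alpha)$ with a linear map $\Delta\colon A\to A^{\otimes 2}$ such that $\alpha^{\otimes 2}\circ\Delta=\Delta\circ\alpha$, $(\alpha\otimes\Delta)\circ\Delta=(\Delta\otimes\alpha)\circ\Delta$, and $\Delta\circ\mu=(\mu\otimes\alpha)\circ(\alpha\otimes\Delta)+(\alpha\otimes\mu)\circ(\Delta\otimes\alpha)$. An element of $A^{\otimes 2}$ is $\alpha$-invariant if it is fixed by $\alpha^{\otimes 2}$. For $a\in A$ and $r=\sum u_i\otimes v_i\in A^{\otimes 2}$, set $$[a,r]_*=\sum\mu(a,u_i)\otimes\alpha(v_i)-\alpha(u_i)\otimes\mu(v_i,a).$$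 A coboundary $\epsilon$-Hom-bialgebra $(A,\mu,\Delta,\alpha,r)$ is an $\epsilon$-Hom-bialgebra $(A,\mu,\Delta,\alpha)$ together with an $\alpha$-invariant $r\in A^{\otimes 2}$ such that $\Delta=[-,r]_*$. For $r=\sum u_i\otimes v_i$, set $$A(r)=\sum_{i,j}\mu(u_i,u_j)\otimes\alpha(v_j)\otimes\alpha(v_i)-\sum_{i,j}\alpha(u_i)\otimes\mu(v_i,u_j)\otimes\alpha(v_j)+\sum_{i,j}\alpha(u_j)\otimes\alpha(u_i)\otimes\mu(v_i,v_j)\in A^{\otimes 3}.$$ For $a\in A$ and $b=\sum b_1\otimes\cdots\otimes b_n\in A^{\otimes n}$, set $$[a,b]_\bullet=\sum\mu(\alpha(a),b_1)\otimes\alpha(b_2)\otimes\cdots\otimes\alpha(b_n)-\alpha(b_1)\otimes\cdots\otimes\alpha(b_{n-1})\otimes\mu(b_n,\alpha(a)).$$ An $n$-tensor $b\in A^{\otimes n}$ is $A$-invariant if $[a,b]_\bullet=0$ for all $a\in A$. *)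

theory Defs
  imports Complex_Main "HOL-Library.Poly_Mapping"
begin

section \<open>Tensor powers of a vector space\<close>

text \<open>
  A vector space over a field is given, as in \<^theory>\<open>HOL.Vector_Spaces\<close>, by its scalar
  multiplication \<open>s :: 'k \<Rightarrow> 'a \<Rightarrow> 'a\<close>.  Its \<open>n\<close>-th tensor power is the textbook quotient: the free
  vector space on the words \<open>[x\<^sub>1, \<dots>, x\<^sub>n]\<close> in \<open>'a\<close>, modulo the span of the elements expressing
  additivity and homogeneity in each slot.  Tensors are therefore equivalence classes of formal
  linear combinations of words, and \<open>x\<^sub>1 \<otimes> \<dots> \<otimes> x\<^sub>n\<close> is the class of \<open>[x\<^sub>1, \<dots>, x\<^sub>n]\<close>.
  Indexing by words makes the identifications such as \<open>A \<otimes> (A \<otimes> A) = (A \<otimes> A) \<otimes> A = A\<^sup>\<otimes>\<^sup>3\<close> implicit.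
\<close>

definition fscale :: "'k::field \<Rightarrow> ('w \<Rightarrow>\<^sub>0 'k) \<Rightarrow> ('w \<Rightarrow>\<^sub>0 'k)"
  where "fscale c p = Poly_Mapping.map (\<lambda>d. c * d) p"

lemma lookup_fscale: "Poly_Mapping.lookup (fscale c p) w = c * Poly_Mapping.lookup p w"
  unfolding fscale_def by transfer (simp add: when_def)

global_interpretation free: vector_space "fscale :: 'k::field \<Rightarrow> ('w \<Rightarrow>\<^sub>0 'k) \<Rightarrow> ('w \<Rightarrow>\<^sub>0 'k)"
  by unfold_locales
    (auto intro!: poly_mapping_eqI simp: lookup_fscale lookup_add algebra_simps)

type_synonym ('a, 'k) tensor = "('a list \<Rightarrow>\<^sub>0 'k) set"

definition free_words :: "nat \<Rightarrow> ('a list \<Rightarrow>\<^sub>0 'k::field) set"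
  where "free_words n = {p. \<forall>w\<in>Poly_Mapping.keys p. length w = n}"

definition tensor_relators ::
    "('k::field \<Rightarrow> 'a::ab_group_add \<Rightarrow> 'a) \<Rightarrow> nat \<Rightarrow> ('a list \<Rightarrow>\<^sub>0 'k) set"
  where "tensor_relators s n =
    {Poly_Mapping.single (xs @ [x + y] @ ys) 1
       - (Poly_Mapping.single (xs @ [x] @ ys) 1 + Poly_Mapping.single (xs @ [y] @ ys) 1)
     | xs x y ys. length xs + 1 + length ys = n} \<union>
    {Poly_Mapping.single (xs @ [s c x] @ ys) 1
       - fscale c (Poly_Mapping.single (xs @ [x] @ ys) 1)
     | xs c x ys. length xs + 1 + length ys = n}"

definition tensor_cong ::
    "('k::field \<Rightarrow> 'a::ab_group_add \<Rightarrow> 'a) \<Rightarrow> nat \<Rightarrow> (('a list \<Rightarrow>\<^sub>0 'k) \<times> ('a list \<Rightarrow>\<^sub>0 'k)) set"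
  where "tensor_cong s n =
    {(p, q). p \<in> free_words n \<and> q \<in> free_words n \<and> p - q \<in> free.span (tensor_relators s n)}"

definition tensor_power ::
    "('k::field \<Rightarrow> 'a::ab_group_add \<Rightarrow> 'a) \<Rightarrow> nat \<Rightarrow> ('a, 'k) tensor set"
  where "tensor_power s n = free_words n // tensor_cong s n"

definition tensor_class ::
    "('k::field \<Rightarrow> 'a::ab_group_add \<Rightarrow> 'a) \<Rightarrow> nat \<Rightarrow> ('a list \<Rightarrow>\<^sub>0 'k) \<Rightarrow> ('a, 'k) tensor"
  where "tensor_class s n p = tensor_cong s n `` {p}"

definition tensor_rep :: "('a, 'k::field) tensor \<Rightarrow> ('a list \<Rightarrow>\<^sub>0 'k)"
  where "tensor_rep X = (SOME p. p \<in> X)"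

definition pure_tensor :: "('k::field \<Rightarrow> 'a::ab_group_add \<Rightarrow> 'a) \<Rightarrow> 'a list \<Rightarrow> ('a, 'k) tensor"
  where "pure_tensor s w = tensor_class s (length w) (Poly_Mapping.single w 1)"

definition tensor_add ::
    "('k::field \<Rightarrow> 'a::ab_group_add \<Rightarrow> 'a) \<Rightarrow> nat \<Rightarrow> ('a, 'k) tensor \<Rightarrow> ('a, 'k) tensor \<Rightarrow> ('a, 'k) tensor"
  where "tensor_add s n X Y = tensor_class s n (tensor_rep X + tensor_rep Y)"

definition tensor_diff ::
    "('k::field \<Rightarrow> 'a::ab_group_add \<Rightarrow> 'a) \<Rightarrow> nat \<Rightarrow> ('a, 'k) tensor \<Rightarrow> ('a, 'k) tensor \<Rightarrow> ('a, 'k) tensor"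
  where "tensor_diff s n X Y = tensor_class s n (tensor_rep X - tensor_rep Y)"

definition tensor_scale ::
    "('k::field \<Rightarrow> 'a::ab_group_add \<Rightarrow> 'a) \<Rightarrow> nat \<Rightarrow> 'k \<Rightarrow> ('a, 'k) tensor \<Rightarrow> ('a, 'k) tensor"
  where "tensor_scale s n c X = tensor_class s n (fscale c (tensor_rep X))"

definition tensor_zero :: "('k::field \<Rightarrow> 'a::ab_group_add \<Rightarrow> 'a) \<Rightarrow> nat \<Rightarrow> ('a, 'k) tensor"
  where "tensor_zero s n = tensor_class s n 0"

text \<open>
  The choice of representative made by \<open>tensor_rep\<close> is immaterial; see \<open>tensor_add_class\<close>,
  \<open>tensor_diff_class\<close>, \<open>tensor_scale_class\<close> and \<open>tensor_lift_class\<close> below.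
\<close>

text \<open>
  The linear map \<open>A\<^sup>\<otimes>\<^sup>n \<rightarrow> A\<^sup>\<otimes>\<^sup>m\<close> induced by an \<open>n\<close>-linear \<open>f\<close>, i.e. sending
  \<open>x\<^sub>1 \<otimes> \<dots> \<otimes> x\<^sub>n\<close> to \<open>f [x\<^sub>1, \<dots>, x\<^sub>n]\<close>; see \<open>tensor_lift_pure\<close>, \<open>tensor_lift_add\<close>
  and \<open>tensor_lift_scale\<close> below.
\<close>

definition tensor_lift ::
    "('k::field \<Rightarrow> 'a::ab_group_add \<Rightarrow> 'a) \<Rightarrow> nat \<Rightarrow> ('a list \<Rightarrow> ('a, 'k) tensor) \<Rightarrow>
     ('a, 'k) tensor \<Rightarrow> ('a, 'k) tensor"
  where "tensor_lift s m f X = tensor_class s m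
    (\<Sum>w\<in>Poly_Mapping.keys (tensor_rep X). fscale (Poly_Mapping.lookup (tensor_rep X) w) (tensor_rep (f w)))"

definition tensor_concat ::
    "('k::field \<Rightarrow> 'a::ab_group_add \<Rightarrow> 'a) \<Rightarrow> nat \<Rightarrow> nat \<Rightarrow>
     ('a, 'k) tensor \<Rightarrow> ('a, 'k) tensor \<Rightarrow> ('a, 'k) tensor"
  where "tensor_concat s m n X Y =
    tensor_lift s (m + n) (\<lambda>v. tensor_lift s (m + n) (\<lambda>w. pure_tensor s (v @ w)) Y) X"


subsection \<open>Well-definedness\<close>

definition multilinear_tensor ::
    "('k::field \<Rightarrow> 'a::ab_group_add \<Rightarrow> 'a) \<Rightarrow> nat \<Rightarrow> nat \<Rightarrow> ('a list \<Rightarrow> ('a, 'k) tensor) \<Rightarrow> bool"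
  where "multilinear_tensor s n m f \<longleftrightarrow>
    (\<forall>w. length w = n \<longrightarrow> f w \<in> tensor_power s m) \<and>
    (\<forall>xs x y ys. length xs + 1 + length ys = n \<longrightarrow>
       f (xs @ [x + y] @ ys) = tensor_add s m (f (xs @ [x] @ ys)) (f (xs @ [y] @ ys))) \<and>
    (\<forall>xs c x ys. length xs + 1 + length ys = n \<longrightarrow>
       f (xs @ [s c x] @ ys) = tensor_scale s m c (f (xs @ [x] @ ys)))"

lemma free_words_subspace: "free.subspace (free_words n)"
  unfolding free.subspace_def free_words_def
  by (auto simp: in_keys_iff lookup_add lookup_fscale)

lemma equiv_tensor_cong: "equiv (free_words n) (tensor_cong s n)"
proof (rule equivI)
  show "tensor_cong s n \<subseteq> free_words n \<times> free_words n"
    by (auto simp: tensor_cong_def)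
  show "refl_on (free_words n) (tensor_cong s n)"
    by (auto simp: refl_on_def tensor_cong_def free.span_zero)
  show "sym (tensor_cong s n)"
  proof (rule symI)
    fix p q assume "(p, q) \<in> tensor_cong s n"
    then show "(q, p) \<in> tensor_cong s n"
      using free.span_neg[of "p - q" "tensor_relators s n"] by (simp add: tensor_cong_def)
  qed
  show "trans (tensor_cong s n)"
  proof (rule transI)
    fix p q t assume "(p, q) \<in> tensor_cong s n" "(q, t) \<in> tensor_cong s n"
    then show "(p, t) \<in> tensor_cong s n"
      using free.span_add[of "p - q" "tensor_relators s n" "q - t"] by (simp add: tensor_cong_def)
  qed
qed

lemma tensor_class_in: "p \<in> free_words n \<Longrightarrow> tensor_class s n p \<in> tensor_power s n"
  unfolding tensor_class_def tensor_power_def by (rule quotientI)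

lemma tensor_class_eq_iff:
  assumes "p \<in> free_words n" "q \<in> free_words n"
  shows "tensor_class s n p = tensor_class s n q \<longleftrightarrow> p - q \<in> free.span (tensor_relators s n)"
  unfolding tensor_class_def eq_equiv_class_iff[OF equiv_tensor_cong assms]
  using assms by (simp add: tensor_cong_def)

lemma
  assumes "X \<in> tensor_power s n"
  shows tensor_rep_in: "tensor_rep X \<in> free_words n"
    and tensor_class_rep: "tensor_class s n (tensor_rep X) = X"
proof -
  obtain p where p: "p \<in> free_words n" "X = tensor_cong s n `` {p}"
    using assms unfolding tensor_power_def by (auto elim: quotientE)
  then have "p \<in> X"
    using equiv_class_self[OF equiv_tensor_cong p(1)] by simp
  then have "tensor_rep X \<in> X" unfolding tensor_rep_def by (rule someI)
  then have rel: "(p, tensor_rep X) \<in> tensor_cong s n" using p(2) by simp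
  then show "tensor_rep X \<in> free_words n" by (simp add: tensor_cong_def)
  show "tensor_class s n (tensor_rep X) = X"
    unfolding tensor_class_def
    using equiv_class_eq[OF equiv_tensor_cong rel] p(2) by simp
qed

lemma tensor_rep_class_in:
  assumes "p \<in> free_words n"
  shows "tensor_rep (tensor_class s n p) \<in> free_words n"
  by (rule tensor_rep_in[OF tensor_class_in[OF assms]])

lemma tensor_rep_class:
  assumes "p \<in> free_words n"
  shows "tensor_rep (tensor_class s n p) - p \<in> free.span (tensor_relators s n)"
proof -
  have "tensor_class s n (tensor_rep (tensor_class s n p)) = tensor_class s n p"
    by (rule tensor_class_rep[OF tensor_class_in[OF assms]])
  then show ?thesis
    by (rule tensor_class_eq_iff[OF tensor_rep_class_in[OF assms] assms, THEN iffD1])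
qed

lemma tensor_add_class:
  assumes "p \<in> free_words n" "q \<in> free_words n"
  shows "tensor_add s n (tensor_class s n p) (tensor_class s n q) = tensor_class s n (p + q)"
proof -
  let ?p = "tensor_rep (tensor_class s n p)" and ?q = "tensor_rep (tensor_class s n q)"
  have "(?p - p) + (?q - q) \<in> free.span (tensor_relators s n)"
    by (intro free.span_add tensor_rep_class assms)
  moreover have "(?p - p) + (?q - q) = (?p + ?q) - (p + q)" by simp
  ultimately show ?thesis unfolding tensor_add_def
    by (subst tensor_class_eq_iff)
      (simp_all only: free.subspace_add[OF free_words_subspace] tensor_rep_class_in assms)
qed

lemma tensor_diff_class:
  assumes "p \<in> free_words n" "q \<in> free_words n"
  shows "tensor_diff s n (tensor_class s n p) (tensor_class s n q) = tensor_class s n (p - q)"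
proof -
  let ?p = "tensor_rep (tensor_class s n p)" and ?q = "tensor_rep (tensor_class s n q)"
  have "(?p - p) - (?q - q) \<in> free.span (tensor_relators s n)"
    by (intro free.span_diff tensor_rep_class assms)
  moreover have "(?p - p) - (?q - q) = (?p - ?q) - (p - q)" by simp
  ultimately show ?thesis unfolding tensor_diff_def
    by (subst tensor_class_eq_iff)
      (simp_all only: free.subspace_diff[OF free_words_subspace] tensor_rep_class_in assms)
qed

lemma tensor_scale_class:
  assumes "p \<in> free_words n"
  shows "tensor_scale s n c (tensor_class s n p) = tensor_class s n (fscale c p)"
proof -
  let ?p = "tensor_rep (tensor_class s n p)"
  have "fscale c (?p - p) \<in> free.span (tensor_relators s n)"
    by (intro free.span_scale tensor_rep_class assms)
  moreover have "fscale c (?p - p) = fscale c ?p - fscale c p"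
    by (rule free.scale_right_diff_distrib)
  ultimately show ?thesis unfolding tensor_scale_def
    by (subst tensor_class_eq_iff)
      (simp_all only: free.subspace_scale[OF free_words_subspace] tensor_rep_class_in assms)
qed

lemma single_in_free_words: "length w = n \<Longrightarrow> Poly_Mapping.single w c \<in> free_words n"
  by (auto simp: free_words_def)

context
  fixes f :: "'a list \<Rightarrow> 'a list \<Rightarrow>\<^sub>0 'k::field"
begin

definition free_ext :: "('a list \<Rightarrow>\<^sub>0 'k) \<Rightarrow> ('a list \<Rightarrow>\<^sub>0 'k)"
  where "free_ext p = (\<Sum>w\<in>Poly_Mapping.keys p. fscale (Poly_Mapping.lookup p w) (f w))"

lemma free_ext_superset:
  assumes "finite K" "Poly_Mapping.keys p \<subseteq> K"
  shows "free_ext p = (\<Sum>w\<in>K. fscale (Poly_Mapping.lookup p w) (f w))"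
  unfolding free_ext_def
  by (rule sum.mono_neutral_left) (use assms in \<open>auto simp: in_keys_iff\<close>)

lemma free_ext_linear: "Vector_Spaces.linear fscale fscale free_ext"
proof unfold_locales
  fix p q :: "'a list \<Rightarrow>\<^sub>0 'k" and c
  let ?K = "Poly_Mapping.keys p \<union> Poly_Mapping.keys q"
  have K: "finite ?K" by simp
  show "free_ext (p + q) = free_ext p + free_ext q"
    using free_ext_superset[OF K, of p] free_ext_superset[OF K, of q]
      free_ext_superset[OF K keys_add]
    by (simp add: lookup_add free.scale_left_distrib sum.distrib)
  have "Poly_Mapping.keys (fscale c p) \<subseteq> Poly_Mapping.keys p" by (auto simp: in_keys_iff lookup_fscale)
  from free_ext_superset[OF _ this]
  show "free_ext (fscale c p) = fscale c (free_ext p)"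
    by (simp add: lookup_fscale free_ext_def free.scale_sum_right)
qed

lemma free_ext_single: "free_ext (Poly_Mapping.single w c) = fscale c (f w)"
  by (simp add: free_ext_def)

lemma free_ext_in:
  assumes "p \<in> free_words n" "\<And>w. length w = n \<Longrightarrow> f w \<in> free_words m"
  shows "free_ext p \<in> free_words m"
  unfolding free_ext_def
  by (intro free.subspace_sum[OF free_words_subspace] free.subspace_scale[OF free_words_subspace])
    (use assms in \<open>auto simp: free_words_def\<close>)

end

lemma tensor_lift_class:
  assumes f: "multilinear_tensor s n m f" and p: "p \<in> free_words n"
  shows "tensor_lift s m f (tensor_class s n p) = tensor_class s m (free_ext (\<lambda>w. tensor_rep (f w)) p)"
proof -
  let ?E = "free_ext (\<lambda>w. tensor_rep (f w))" and ?N = "\<lambda>k. free.span (tensor_relators s k)"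
  interpret E: Vector_Spaces.linear fscale fscale ?E by (rule free_ext_linear)
  have f_in: "f w \<in> tensor_power s m" if "length w = n" for w
    using f that by (simp add: multilinear_tensor_def)
  have rep_in: "tensor_rep (f w) \<in> free_words m" if "length w = n" for w
    using f_in[OF that] by (rule tensor_rep_in)
  have gen: "?E g \<in> ?N m" if g: "g \<in> tensor_relators s n" for g
  proof -
    consider (add) xs x y ys where
      "g = Poly_Mapping.single (xs @ [x + y] @ ys) 1
        - (Poly_Mapping.single (xs @ [x] @ ys) 1 + Poly_Mapping.single (xs @ [y] @ ys) 1)"
      "length xs + 1 + length ys = n"
    | (scale) xs c x ys where
      "g = Poly_Mapping.single (xs @ [s c x] @ ys) 1
        - fscale c (Poly_Mapping.single (xs @ [x] @ ys) 1)"
      "length xs + 1 + length ys = n"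
      using g unfolding tensor_relators_def by blast
    then show "?E g \<in> ?N m"
    proof cases
      case add
      note g_eq = add(1) and len = add(2)
      have l: "length (xs @ [x] @ ys) = n" "length (xs @ [y] @ ys) = n" "length (xs @ [x + y] @ ys) = n"
        using len by auto
      have "f (xs @ [x + y] @ ys) = tensor_add s m (f (xs @ [x] @ ys)) (f (xs @ [y] @ ys))"
        using f len unfolding multilinear_tensor_def by blast
      then have "tensor_class s m (tensor_rep (f (xs @ [x + y] @ ys))) =
          tensor_class s m (tensor_rep (f (xs @ [x] @ ys)) + tensor_rep (f (xs @ [y] @ ys)))"
        using tensor_class_rep[OF f_in[OF l(3)]] by (simp add: tensor_add_def)
      then show "?E g \<in> ?N m"
        unfolding g_eq E.diff E.add free_ext_single free.scale_one
        by (subst tensor_class_eq_iff[symmetric])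
          (intro rep_in l free.subspace_add[OF free_words_subspace] | assumption)+
    next
      case scale
      note g_eq = scale(1) and len = scale(2)
      have l: "length (xs @ [x] @ ys) = n" "length (xs @ [s c x] @ ys) = n"
        using len by auto
      have "f (xs @ [s c x] @ ys) = tensor_scale s m c (f (xs @ [x] @ ys))"
        using f len unfolding multilinear_tensor_def by blast
      then have "tensor_class s m (tensor_rep (f (xs @ [s c x] @ ys))) =
          tensor_class s m (fscale c (tensor_rep (f (xs @ [x] @ ys))))"
        using tensor_class_rep[OF f_in[OF l(2)]] by (simp add: tensor_scale_def)
      then show "?E g \<in> ?N m"
        unfolding g_eq E.diff E.scale free_ext_single free.scale_one
        by (subst tensor_class_eq_iff[symmetric])
          (intro rep_in l free.subspace_scale[OF free_words_subspace] | assumption)+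
    qed
  qed
  have N: "?E g \<in> ?N m" if "g \<in> ?N n" for g
  proof -
    have "?E ` ?N n = free.span (?E ` tensor_relators s n)"
      by (rule E.span_image[symmetric])
    also have "\<dots> \<subseteq> ?N m"
      by (rule free.span_minimal) (use gen in auto)
    finally show ?thesis using that by blast
  qed
  let ?p = "tensor_rep (tensor_class s n p)"
  have "?E (?p - p) \<in> ?N m" by (intro N tensor_rep_class p)
  then have "?E ?p - ?E p \<in> ?N m" by (simp add: E.diff)
  moreover have E_in: "?E q \<in> free_words m" if "q \<in> free_words n" for q
    using that rep_in by (rule free_ext_in)
  ultimately have "tensor_class s m (?E ?p) = tensor_class s m (?E p)"
    by (simp add: tensor_class_eq_iff p tensor_rep_class_in)
  then show ?thesis
    by (simp only: tensor_lift_def free_ext_def)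
qed

lemma tensor_lift_pure:
  assumes "multilinear_tensor s n m f" "length w = n"
  shows "tensor_lift s m f (pure_tensor s w) = f w"
proof -
  have "f w \<in> tensor_power s m" using assms by (simp add: multilinear_tensor_def)
  then show ?thesis
    using tensor_lift_class[OF assms(1) single_in_free_words[OF assms(2)]] assms(2)
    by (simp add: pure_tensor_def free_ext_single tensor_class_rep)
qed

lemma tensor_lift_add:
  assumes f: "multilinear_tensor s n m f" and XY: "X \<in> tensor_power s n" "Y \<in> tensor_power s n"
  shows "tensor_lift s m f (tensor_add s n X Y) =
    tensor_add s m (tensor_lift s m f X) (tensor_lift s m f Y)"
proof -
  let ?E = "free_ext (\<lambda>w. tensor_rep (f w))"
  interpret E: Vector_Spaces.linear fscale fscale ?E by (rule free_ext_linear)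
  have E_in: "?E p \<in> free_words m" if "p \<in> free_words n" for p
    using that f by (intro free_ext_in[where n = n]) (auto simp: multilinear_tensor_def tensor_rep_in)
  have lift: "tensor_lift s m f Z = tensor_class s m (?E (tensor_rep Z))"
    if "Z \<in> tensor_power s n" for Z
    using tensor_lift_class[OF f tensor_rep_in[OF that]] tensor_class_rep[OF that] by simp
  have "tensor_rep X + tensor_rep Y \<in> free_words n"
    using XY by (intro free.subspace_add[OF free_words_subspace] tensor_rep_in)
  from tensor_lift_class[OF f this]
  show ?thesis
    unfolding lift[OF XY(1)] lift[OF XY(2)]
    by (simp only: tensor_add_def[of s n X Y] tensor_add_class E_in tensor_rep_in[OF XY(1)]
        tensor_rep_in[OF XY(2)] E.add)
qed

lemma tensor_lift_scale:
  assumes f: "multilinear_tensor s n m f" and X: "X \<in> tensor_power s n"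
  shows "tensor_lift s m f (tensor_scale s n c X) = tensor_scale s m c (tensor_lift s m f X)"
proof -
  let ?E = "free_ext (\<lambda>w. tensor_rep (f w))"
  interpret E: Vector_Spaces.linear fscale fscale ?E by (rule free_ext_linear)
  have E_in: "?E p \<in> free_words m" if "p \<in> free_words n" for p
    using that f by (intro free_ext_in[where n = n]) (auto simp: multilinear_tensor_def tensor_rep_in)
  have lift: "tensor_lift s m f X = tensor_class s m (?E (tensor_rep X))"
    using tensor_lift_class[OF f tensor_rep_in[OF X]] tensor_class_rep[OF X] by simp
  have "fscale c (tensor_rep X) \<in> free_words n"
    using X by (intro free.subspace_scale[OF free_words_subspace] tensor_rep_in)
  from tensor_lift_class[OF f this]
  show ?thesis
    unfolding lift
    by (simp only: tensor_scale_def[of s n c X] tensor_scale_class E_in tensor_rep_in[OF X] E.scale)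
qed


section \<open>Hom-associative algebras and epsilon-Hom-bialgebras\<close>

definition hom_associative ::
    "('k::field \<Rightarrow> 'a::ab_group_add \<Rightarrow> 'a) \<Rightarrow> ('a \<Rightarrow> 'a \<Rightarrow> 'a) \<Rightarrow> ('a \<Rightarrow> 'a) \<Rightarrow> bool"
  where "hom_associative s \<mu> \<alpha> \<longleftrightarrow>
    vector_space s \<and>
    (\<forall>x. Vector_Spaces.linear s s (\<lambda>y. \<mu> x y)) \<and>
    (\<forall>y. Vector_Spaces.linear s s (\<lambda>x. \<mu> x y)) \<and>
    Vector_Spaces.linear s s \<alpha> \<and>
    (\<forall>x y. \<alpha> (\<mu> x y) = \<mu> (\<alpha> x) (\<alpha> y)) \<and>
    (\<forall>x y z. \<mu> (\<alpha> x) (\<mu> y z) = \<mu> (\<mu> x y) (\<alpha> z))"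

definition alpha_alpha ::
    "('k::field \<Rightarrow> 'a::ab_group_add \<Rightarrow> 'a) \<Rightarrow> ('a \<Rightarrow> 'a) \<Rightarrow> ('a, 'k) tensor \<Rightarrow> ('a, 'k) tensor"
  where "alpha_alpha s \<alpha> = tensor_lift s 2 (\<lambda>w. pure_tensor s [\<alpha> (w ! 0), \<alpha> (w ! 1)])"

definition alpha_mu ::
    "('k::field \<Rightarrow> 'a::ab_group_add \<Rightarrow> 'a) \<Rightarrow> ('a \<Rightarrow> 'a \<Rightarrow> 'a) \<Rightarrow> ('a \<Rightarrow> 'a) \<Rightarrow>
     ('a, 'k) tensor \<Rightarrow> ('a, 'k) tensor"
  where "alpha_mu s \<mu> \<alpha> = tensor_lift s 2 (\<lambda>w. pure_tensor s [\<alpha> (w ! 0), \<mu> (w ! 1) (w ! 2)])"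

definition mu_alpha ::
    "('k::field \<Rightarrow> 'a::ab_group_add \<Rightarrow> 'a) \<Rightarrow> ('a \<Rightarrow> 'a \<Rightarrow> 'a) \<Rightarrow> ('a \<Rightarrow> 'a) \<Rightarrow>
     ('a, 'k) tensor \<Rightarrow> ('a, 'k) tensor"
  where "mu_alpha s \<mu> \<alpha> = tensor_lift s 2 (\<lambda>w. pure_tensor s [\<mu> (w ! 0) (w ! 1), \<alpha> (w ! 2)])"

definition alpha_Delta ::
    "('k::field \<Rightarrow> 'a::ab_group_add \<Rightarrow> 'a) \<Rightarrow> ('a \<Rightarrow> 'a) \<Rightarrow> ('a \<Rightarrow> ('a, 'k) tensor) \<Rightarrow>
     ('a, 'k) tensor \<Rightarrow> ('a, 'k) tensor"
  where "alpha_Delta s \<alpha> \<Delta> =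
    tensor_lift s 3 (\<lambda>w. tensor_concat s 1 2 (pure_tensor s [\<alpha> (w ! 0)]) (\<Delta> (w ! 1)))"

definition Delta_alpha ::
    "('k::field \<Rightarrow> 'a::ab_group_add \<Rightarrow> 'a) \<Rightarrow> ('a \<Rightarrow> 'a) \<Rightarrow> ('a \<Rightarrow> ('a, 'k) tensor) \<Rightarrow>
     ('a, 'k) tensor \<Rightarrow> ('a, 'k) tensor"
  where "Delta_alpha s \<alpha> \<Delta> =
    tensor_lift s 3 (\<lambda>w. tensor_concat s 2 1 (\<Delta> (w ! 0)) (pure_tensor s [\<alpha> (w ! 1)]))"

definition eps_hom_bialgebra ::
    "('k::field \<Rightarrow> 'a::ab_group_add \<Rightarrow> 'a) \<Rightarrow> ('a \<Rightarrow> 'a \<Rightarrow> 'a) \<Rightarrow> ('a \<Rightarrow> ('a, 'k) tensor) \<Rightarrow>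
     ('a \<Rightarrow> 'a) \<Rightarrow> bool"
  where "eps_hom_bialgebra s \<mu> \<Delta> \<alpha> \<longleftrightarrow>
    hom_associative s \<mu> \<alpha> \<and>
    (\<forall>a. \<Delta> a \<in> tensor_power s 2) \<and>
    (\<forall>a b. \<Delta> (a + b) = tensor_add s 2 (\<Delta> a) (\<Delta> b)) \<and>
    (\<forall>c a. \<Delta> (s c a) = tensor_scale s 2 c (\<Delta> a)) \<and>
    (\<forall>a. alpha_alpha s \<alpha> (\<Delta> a) = \<Delta> (\<alpha> a)) \<and>
    (\<forall>a. alpha_Delta s \<alpha> \<Delta> (\<Delta> a) = Delta_alpha s \<alpha> \<Delta> (\<Delta> a)) \<and>
    (\<forall>a b. \<Delta> (\<mu> a b) =
       tensor_add s 2 (mu_alpha s \<mu> \<alpha> (alpha_Delta s \<alpha> \<Delta> (pure_tensor s [a, b])))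
                      (alpha_mu s \<mu> \<alpha> (Delta_alpha s \<alpha> \<Delta> (pure_tensor s [a, b]))))"

definition alpha_invariant ::
    "('k::field \<Rightarrow> 'a::ab_group_add \<Rightarrow> 'a) \<Rightarrow> ('a \<Rightarrow> 'a) \<Rightarrow> ('a, 'k) tensor \<Rightarrow> bool"
  where "alpha_invariant s \<alpha> r \<longleftrightarrow> alpha_alpha s \<alpha> r = r"

definition star_bracket ::
    "('k::field \<Rightarrow> 'a::ab_group_add \<Rightarrow> 'a) \<Rightarrow> ('a \<Rightarrow> 'a \<Rightarrow> 'a) \<Rightarrow> ('a \<Rightarrow> 'a) \<Rightarrow>
     'a \<Rightarrow> ('a, 'k) tensor \<Rightarrow> ('a, 'k) tensor"
  where "star_bracket s \<mu> \<alpha> a r =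
    tensor_lift s 2
      (\<lambda>w. let u = w ! 0; v = w ! 1 in
        tensor_diff s 2 (pure_tensor s [\<mu> a u, \<alpha> v]) (pure_tensor s [\<alpha> u, \<mu> v a])) r"

definition coboundary_eps_hom_bialgebra ::
    "('k::field \<Rightarrow> 'a::ab_group_add \<Rightarrow> 'a) \<Rightarrow> ('a \<Rightarrow> 'a \<Rightarrow> 'a) \<Rightarrow> ('a \<Rightarrow> ('a, 'k) tensor) \<Rightarrow>
     ('a \<Rightarrow> 'a) \<Rightarrow> ('a, 'k) tensor \<Rightarrow> bool"
  where "coboundary_eps_hom_bialgebra s \<mu> \<Delta> \<alpha> r \<longleftrightarrow>
    eps_hom_bialgebra s \<mu> \<Delta> \<alpha> \<and>
    r \<in> tensor_power s 2 \<and> alpha_invariant s \<alpha> r \<and>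
    \<Delta> = (\<lambda>a. star_bracket s \<mu> \<alpha> a r)"

text \<open>
  The element \<open>A(r)\<close>: the outer lift runs over the terms \<open>u\<^sub>i \<otimes> v\<^sub>i\<close> of \<open>r\<close> and the inner one over
  the terms \<open>u\<^sub>j \<otimes> v\<^sub>j\<close>.
\<close>

definition A_elem ::
    "('k::field \<Rightarrow> 'a::ab_group_add \<Rightarrow> 'a) \<Rightarrow> ('a \<Rightarrow> 'a \<Rightarrow> 'a) \<Rightarrow> ('a \<Rightarrow> 'a) \<Rightarrow>
     ('a, 'k) tensor \<Rightarrow> ('a, 'k) tensor"
  where "A_elem s \<mu> \<alpha> r =
    tensor_lift s 3 (\<lambda>w. tensor_lift s 3
      (\<lambda>w'. let ui = w ! 0; vi = w ! 1; uj = w' ! 0; vj = w' ! 1 in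
        tensor_add s 3
          (tensor_diff s 3 (pure_tensor s [\<mu> ui uj, \<alpha> vj, \<alpha> vi]) (pure_tensor s [\<alpha> ui, \<mu> vi uj, \<alpha> vj]))
          (pure_tensor s [\<alpha> uj, \<alpha> ui, \<mu> vi vj])) r) r"

text \<open>For \<open>n \<ge> 1\<close>; on the empty word \<open>hd\<close> and \<open>last\<close> are unspecified.\<close>

definition bullet_bracket ::
    "('k::field \<Rightarrow> 'a::ab_group_add \<Rightarrow> 'a) \<Rightarrow> ('a \<Rightarrow> 'a \<Rightarrow> 'a) \<Rightarrow> ('a \<Rightarrow> 'a) \<Rightarrow> nat \<Rightarrow>
     'a \<Rightarrow> ('a, 'k) tensor \<Rightarrow> ('a, 'k) tensor"
  where "bullet_bracket s \<mu> \<alpha> n a b =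
    tensor_lift s n
      (\<lambda>w. tensor_diff s n
        (pure_tensor s (\<mu> (\<alpha> a) (hd w) # map \<alpha> (tl w)))
        (pure_tensor s (map \<alpha> (butlast w) @ [\<mu> (last w) (\<alpha> a)]))) b"

definition A_invariant ::
    "('k::field \<Rightarrow> 'a::ab_group_add \<Rightarrow> 'a) \<Rightarrow> ('a \<Rightarrow> 'a \<Rightarrow> 'a) \<Rightarrow> ('a \<Rightarrow> 'a) \<Rightarrow> nat \<Rightarrow>
     ('a, 'k) tensor \<Rightarrow> bool"
  where "A_invariant s \<mu> \<alpha> n b \<longleftrightarrow> (\<forall>a. bullet_bracket s \<mu> \<alpha> n a b = tensor_zero s n)"

end

theory Submission
  imports Defs
begin

text \<open>
  Tensors are separated by multilinear forms, so every identity between tensors may be tested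
  against a form \<open>T\<close>, where it becomes an identity between sums over the terms of \<open>r\<close>.
  Invariance of \<open>r\<close> allows replacing \<open>u \<otimes> v\<close> by \<open>\<alpha> u \<otimes> \<alpha> v\<close> in such a sum; with this,
  compatibility of \<open>\<Delta>\<close> with \<open>\<mu>\<close> and \<open>\<alpha>\<close> is automatic, and
  \<open>(\<alpha> \<otimes> \<Delta>) \<Delta> a - (\<Delta> \<otimes> \<alpha>) \<Delta> a = - [a, A(r)]\<^sub>\<bullet>\<close> by Hom-associativity.
\<close>

section \<open>Testing tensors against multilinear forms\<close>

text \<open>Spelled out by equations because \<open>s\<close> is an arbitrary operation in this
  section, whereas \<open>Vector_Spaces.linear\<close> carries the vector space axioms with
  it.\<close>

definition linear_form :: "('k::field \<Rightarrow> 'a::ab_group_add \<Rightarrow> 'a) \<Rightarrow> ('a \<Rightarrow> 'k) \<Rightarrow> bool"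
  where "linear_form s \<phi> \<longleftrightarrow> (\<forall>x y. \<phi> (x + y) = \<phi> x + \<phi> y) \<and> (\<forall>c x. \<phi> (s c x) = c * \<phi> x)"

definition multilinear_form ::
    "('k::field \<Rightarrow> 'a::ab_group_add \<Rightarrow> 'a) \<Rightarrow> nat \<Rightarrow> ('a list \<Rightarrow> 'k) \<Rightarrow> bool"
  where "multilinear_form s n T \<longleftrightarrow>
    (\<forall>xs ys. length xs + 1 + length ys = n \<longrightarrow> linear_form s (\<lambda>x. T (xs @ [x] @ ys)))"

definition pairing :: "('w \<Rightarrow> 'k::field) \<Rightarrow> ('w \<Rightarrow>\<^sub>0 'k) \<Rightarrow> 'k"
  where "pairing T p = (\<Sum>w\<in>Poly_Mapping.keys p. Poly_Mapping.lookup p w * T w)"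

text \<open>The value is independent of the representative when \<open>T\<close> is multilinear, by
  \<open>tensor_eval_class\<close>. For other \<open>T\<close> it is still a finite sum over one
  fixed representative, which is all that rules such as \<open>tensor_eval_swap\<close> use.\<close>

definition tensor_eval :: "('a list \<Rightarrow> 'k::field) \<Rightarrow> ('a, 'k) tensor \<Rightarrow> 'k"
  where "tensor_eval T X = pairing T (tensor_rep X)"

section \<open>Pairing with forms, and separation of tensors\<close>

lemma pairing_superset:
  assumes "finite K" "Poly_Mapping.keys p \<subseteq> K"
  shows "pairing T p = (\<Sum>w\<in>K. Poly_Mapping.lookup p w * T w)"
  unfolding pairing_def
  by (rule sum.mono_neutral_left) (use assms in \<open>auto simp: in_keys_iff\<close>)

lemma vector_space_mult: "vector_space ((*) :: 'k::field \<Rightarrow> 'k \<Rightarrow> 'k)"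
  by unfold_locales (auto simp: algebra_simps)

lemma pairing_add: "pairing T (p + q) = pairing T p + pairing T q"
proof -
  let ?K = "Poly_Mapping.keys p \<union> Poly_Mapping.keys q"
  have "finite ?K" by simp
  then show ?thesis
    using keys_add[of p q] by (simp add: pairing_superset[of ?K] lookup_add distrib_right sum.distrib)
qed

lemma pairing_scale: "pairing T (fscale c p) = c * pairing T p"
proof -
  have "Poly_Mapping.keys (fscale c p) \<subseteq> Poly_Mapping.keys p"
    by (auto simp: in_keys_iff lookup_fscale)
  then show ?thesis
    by (simp add: pairing_superset[of "Poly_Mapping.keys p"] lookup_fscale sum_distrib_left mult.assoc)
qed

lemma pairing_diff: "pairing T (p - q) = pairing T p - pairing T q"
  using pairing_add[of T "p - q" q] by simp

lemma pairing_sum: "pairing T (\<Sum>i\<in>I. h i) = (\<Sum>i\<in>I. pairing T (h i))"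
  by (induction I rule: infinite_finite_induct) (simp_all add: pairing_add, simp_all add: pairing_def)

lemma pairing_single: "pairing T (Poly_Mapping.single w c) = c * T w"
  by (simp add: pairing_def)

text \<open>The kernel of the pairing is a subspace, and linearity of \<open>T\<close> in each slot
  says that it contains the relators.\<close>

lemma pairing_relators:
  assumes T: "multilinear_form s n T" and p: "p \<in> free.span (tensor_relators s n)"
  shows "pairing T p = 0"
proof -
  have "free.subspace {q. pairing T q = 0}"
    by (auto simp: free.subspace_def pairing_add pairing_scale) (simp add: pairing_def)
  moreover have "tensor_relators s n \<subseteq> {q. pairing T q = 0}"
    using T unfolding tensor_relators_def multilinear_form_def linear_form_def
    by (auto simp: pairing_add pairing_diff pairing_scale pairing_single)
  ultimately show ?thesis
    using free.span_minimal p by blast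
qed

text \<open>A basis \<open>B\<close> of the span stays independent when \<open>p\<close> is added,
  so the values 0 on \<open>B\<close> and 1 at \<open>p\<close> extend to a linear
  functional.\<close>

lemma separating_functional:
  fixes p :: "'w \<Rightarrow>\<^sub>0 'k::field"
  assumes "p \<notin> free.span N"
  obtains g where "Vector_Spaces.linear fscale (*) g" "\<And>q. q \<in> free.span N \<Longrightarrow> g q = 0" "g p = (1 :: 'k)"
proof -
  interpret vector_space_pair "fscale :: 'k \<Rightarrow> ('w \<Rightarrow>\<^sub>0 'k) \<Rightarrow> _" "(*) :: 'k \<Rightarrow> 'k \<Rightarrow> 'k"
    by (simp add: vector_space_pair_def vector_space_mult free.vector_space_axioms)
  obtain B where B: "B \<subseteq> free.span N" "free.independent B" "free.span N \<subseteq> free.span B"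
    by (rule free.maximal_independent_subset)
  have "p \<notin> free.span B"
    using assms free.span_minimal[OF B(1) free.subspace_span] by blast
  then have "free.independent (insert p B)"
    using B(2) by (rule free.independent_insertI)
  from linear_independent_extend[OF this(1), of "\<lambda>x. if x = p then 1 else 0"]
  obtain g where "Vector_Spaces.linear fscale (*) g"
      "\<forall>x\<in>insert p B. g x = (if x = p then 1 else 0 :: 'k)" by blast
  \<comment> \<open>Without this, the prescribed values 1 at \<open>p\<close> and 0 on
    \<open>B\<close> could clash.\<close>
  moreover have "p \<notin> B"
    using \<open>p \<notin> free.span B\<close> free.span_base by blast
  ultimately have g: "Vector_Spaces.linear fscale (*) g" "\<forall>x\<in>B. g x = 0" "g p = 1"
    by auto
  have "g q = 0" if "q \<in> free.span N" for q
    using linear_eq_0_on_span[OF g(1), of B q] g(2) B(3) that by blast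
  with g that show ?thesis by blast
qed

text \<open>By contraposition: a functional \<open>g\<close> that separates \<open>p\<close> from
  the span restricts to a function \<open>T\<close> on words. Vanishing of \<open>g\<close> on the
  relators makes \<open>T\<close> multilinear, and since words form a basis, pairing with
  \<open>T\<close> gives back \<open>g\<close>.\<close>

lemma pairing_separates:
  fixes s :: "'k::field \<Rightarrow> 'a::ab_group_add \<Rightarrow> 'a"
  assumes "\<And>T. multilinear_form s n T \<Longrightarrow> pairing T p = 0"
  shows "p \<in> free.span (tensor_relators s n)"
proof (rule ccontr)
  assume "p \<notin> free.span (tensor_relators s n)"
  then obtain g where g: "Vector_Spaces.linear fscale (*) g"
      "\<And>q. q \<in> free.span (tensor_relators s n) \<Longrightarrow> g q = 0" "g p = 1"
    by (rule separating_functional) blast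
  interpret g: Vector_Spaces.linear fscale "(*)" g by (rule g(1))
  define T where "T w = g (Poly_Mapping.single w 1)" for w
  have rel: "g q = 0" if "q \<in> tensor_relators s n" for q
    using g(2) free.span_base that by blast
  have "linear_form s (\<lambda>x. T (xs @ [x] @ ys))" if "length xs + 1 + length ys = n" for xs ys
    unfolding linear_form_def
  proof (intro conjI allI)
    fix x y c
    have "Poly_Mapping.single (xs @ [x + y] @ ys) 1
       - (Poly_Mapping.single (xs @ [x] @ ys) 1 + Poly_Mapping.single (xs @ [y] @ ys) 1)
       \<in> tensor_relators s n"
      using that unfolding tensor_relators_def by blast
    from rel[OF this] show "T (xs @ [x + y] @ ys) = T (xs @ [x] @ ys) + T (xs @ [y] @ ys)"
      by (simp add: T_def g.diff g.add)
    have "Poly_Mapping.single (xs @ [s c x] @ ys) 1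
       - fscale c (Poly_Mapping.single (xs @ [x] @ ys) 1) \<in> tensor_relators s n"
      using that unfolding tensor_relators_def by blast
    from rel[OF this] show "T (xs @ [s c x] @ ys) = c * T (xs @ [x] @ ys)"
      by (simp add: T_def g.diff g.scale)
  qed
  then have "multilinear_form s n T" by (simp add: multilinear_form_def)
  then have "pairing T p = 0" by (rule assms)
  moreover have "g p = pairing T p"
  proof -
    \<comment> \<open>The expansion of \<open>p\<close> in the basis of words.\<close>
    have "p = (\<Sum>w\<in>Poly_Mapping.keys p. fscale (Poly_Mapping.lookup p w) (Poly_Mapping.single w 1))"
      by (rule poly_mapping_eqI)
        (simp add: lookup_sum lookup_fscale lookup_single when_def in_keys_iff if_distrib sum.delta cong: if_cong)
    then have "g p = g (\<Sum>w\<in>Poly_Mapping.keys p. fscale (Poly_Mapping.lookup p w) (Poly_Mapping.single w 1))"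
      by simp
    then show ?thesis
      by (simp add: g.sum g.scale T_def pairing_def)
  qed
  ultimately show False using g(3) by simp
qed

lemma tensor_eval_class:
  assumes "multilinear_form s n T" "p \<in> free_words n"
  shows "tensor_eval T (tensor_class s n p) = pairing T p"
  using pairing_relators[OF assms(1) tensor_rep_class[OF assms(2)]]
  by (simp add: tensor_eval_def pairing_diff)

text \<open>Equal evaluations put the difference of the representatives into the span of the
  relators. The identities for \<open>Delta\<close> below are all reduced to scalars by this
  rule.\<close>

lemma tensor_eqI:
  assumes X: "X \<in> tensor_power s n" and Y: "Y \<in> tensor_power s n"
    and eq: "\<And>T. multilinear_form s n T \<Longrightarrow> tensor_eval T X = tensor_eval T Y"
  shows "X = Y"
proof -
  have "tensor_rep X - tensor_rep Y \<in> free.span (tensor_relators s n)"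
    using eq by (intro pairing_separates) (simp add: pairing_diff tensor_eval_def)
  then have "tensor_class s n (tensor_rep X) = tensor_class s n (tensor_rep Y)"
    using tensor_class_eq_iff[OF tensor_rep_in[OF X] tensor_rep_in[OF Y]] by blast
  then show ?thesis
    using tensor_class_rep[OF X] tensor_class_rep[OF Y] by simp
qed

section \<open>Closure of tensor powers under the tensor operations\<close>

lemma pure_tensor_in: "length w = n \<Longrightarrow> pure_tensor s w \<in> tensor_power s n"
  unfolding pure_tensor_def by (auto intro: tensor_class_in single_in_free_words)

lemma tensor_zero_in: "tensor_zero s n \<in> tensor_power s n"
  unfolding tensor_zero_def by (intro tensor_class_in free.subspace_0 free_words_subspace)

lemma
  assumes "X \<in> tensor_power s n" "Y \<in> tensor_power s n"
  shows tensor_add_in: "tensor_add s n X Y \<in> tensor_power s n"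
    and tensor_diff_in: "tensor_diff s n X Y \<in> tensor_power s n"
  unfolding tensor_add_def tensor_diff_def
  by (intro tensor_class_in free.subspace_add free.subspace_diff free_words_subspace
      tensor_rep_in[OF assms(1)] tensor_rep_in[OF assms(2)])+

lemma tensor_scale_in: "X \<in> tensor_power s n \<Longrightarrow> tensor_scale s n c X \<in> tensor_power s n"
  unfolding tensor_scale_def
  by (intro tensor_class_in free.subspace_scale free_words_subspace tensor_rep_in)

lemma length_tensor_rep:
  "X \<in> tensor_power s n \<Longrightarrow> w \<in> Poly_Mapping.keys (tensor_rep X) \<Longrightarrow> length w = n"
  using tensor_rep_in[of X s n] by (auto simp: free_words_def)

lemma free_ext_tensor_rep_in:
  assumes "X \<in> tensor_power s n" "\<And>w. length w = n \<Longrightarrow> f w \<in> tensor_power s m"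
  shows "free_ext (\<lambda>w. tensor_rep (f w)) (tensor_rep X) \<in> free_words m"
  using tensor_rep_in[OF assms(1)] tensor_rep_in[OF assms(2)] by (rule free_ext_in)

lemma tensor_lift_in:
  assumes "X \<in> tensor_power s n" "\<And>w. length w = n \<Longrightarrow> f w \<in> tensor_power s m"
  shows "tensor_lift s m f X \<in> tensor_power s m"
  using tensor_class_in[OF free_ext_tensor_rep_in[OF assms]]
  by (simp only: tensor_lift_def free_ext_def)

section \<open>Evaluation of the tensor operations\<close>

context
  fixes s :: "'k::field \<Rightarrow> 'a::ab_group_add \<Rightarrow> 'a" and n T
  assumes T: "multilinear_form s n T"
begin

lemma tensor_eval_pure: "length w = n \<Longrightarrow> tensor_eval T (pure_tensor s w) = T w"
  unfolding pure_tensor_def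
  using tensor_eval_class[OF T single_in_free_words[of w n 1]] by (simp add: pairing_single)

lemma tensor_eval_zero: "tensor_eval T (tensor_zero s n) = 0"
  unfolding tensor_zero_def
  using tensor_eval_class[OF T free.subspace_0[OF free_words_subspace]]
  by (simp add: pairing_def)

lemma tensor_eval_add:
  assumes "X \<in> tensor_power s n" "Y \<in> tensor_power s n"
  shows "tensor_eval T (tensor_add s n X Y) = tensor_eval T X + tensor_eval T Y"
  unfolding tensor_add_def
  by (subst tensor_eval_class[OF T])
    (auto intro: free.subspace_add[OF free_words_subspace] tensor_rep_in assms
      simp: pairing_add tensor_eval_def)

lemma tensor_eval_diff:
  assumes "X \<in> tensor_power s n" "Y \<in> tensor_power s n"
  shows "tensor_eval T (tensor_diff s n X Y) = tensor_eval T X - tensor_eval T Y"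
  unfolding tensor_diff_def
  by (subst tensor_eval_class[OF T])
    (auto intro: free.subspace_diff[OF free_words_subspace] tensor_rep_in assms
      simp: pairing_diff tensor_eval_def)

lemma tensor_eval_scale:
  assumes "X \<in> tensor_power s n"
  shows "tensor_eval T (tensor_scale s n c X) = c * tensor_eval T X"
  unfolding tensor_scale_def
  by (subst tensor_eval_class[OF T])
    (auto intro: free.subspace_scale[OF free_words_subspace] tensor_rep_in assms
      simp: pairing_scale tensor_eval_def)

text \<open>The lift and the outer evaluation expand the same representative of \<open>X\<close>, so
  after passing to a representative of the lift this is linearity of the pairing.\<close>

lemma tensor_eval_lift:
  assumes "X \<in> tensor_power s m" "\<And>w. length w = m \<Longrightarrow> f w \<in> tensor_power s n"
  shows "tensor_eval T (tensor_lift s n f X) = tensor_eval (\<lambda>w. tensor_eval T (f w)) X"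
proof -
  have "tensor_eval T (tensor_lift s n f X) =
      pairing T (free_ext (\<lambda>w. tensor_rep (f w)) (tensor_rep X))"
    using tensor_eval_class[OF T free_ext_tensor_rep_in[OF assms]]
    by (simp only: tensor_lift_def free_ext_def)
  also have "\<dots> = tensor_eval (\<lambda>w. tensor_eval T (f w)) X"
    by (simp add: free_ext_def pairing_sum pairing_scale tensor_eval_def pairing_def[of _ "tensor_rep X"])
  finally show ?thesis .
qed

end

section \<open>Sums over the terms of a tensor, and contraction of forms\<close>

lemma tensor_eval_cong:
  assumes "X \<in> tensor_power s n" "\<And>w. length w = n \<Longrightarrow> T w = T' w"
  shows "tensor_eval T X = tensor_eval T' X"
  unfolding tensor_eval_def pairing_def
  using length_tensor_rep[OF assms(1)] assms(2) by (auto intro!: sum.cong)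

lemma tensor_eval_plus: "tensor_eval (\<lambda>w. T w + T' w) X = tensor_eval T X + tensor_eval T' X"
  and tensor_eval_minus: "tensor_eval (\<lambda>w. T w - T' w) X = tensor_eval T X - tensor_eval T' X"
  and tensor_eval_times: "tensor_eval (\<lambda>w. c * T w) X = c * tensor_eval T X"
  by (simp_all add: tensor_eval_def pairing_def algebra_simps sum.distrib sum_subtractf sum_distrib_left)

lemma tensor_eval_swap:
  "tensor_eval (\<lambda>v. tensor_eval (\<lambda>w. G v w) Y) X = tensor_eval (\<lambda>w. tensor_eval (\<lambda>v. G v w) X) Y"
  unfolding tensor_eval_def pairing_def sum_distrib_left
  by (subst sum.swap) (simp add: mult.left_commute)

text \<open>Replaces the prefix and suffix lists by named arguments, so that the simplifier can
  check concrete forms slot by slot. \<open>multilinear_form_3\<close> does the same for three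
  slots.\<close>

lemma multilinear_form_2:
  fixes s :: "'k::field \<Rightarrow> 'a::ab_group_add \<Rightarrow> 'a"
  shows "multilinear_form s 2 T \<longleftrightarrow>
    (\<forall>y. linear_form s (\<lambda>x. T [x, y])) \<and> (\<forall>x. linear_form s (\<lambda>y. T [x, y]))"
  (is "?L \<longleftrightarrow> ?R")
proof
  assume L: ?L
  have *: "linear_form s (\<lambda>x. T (xs @ [x] @ ys))" if "length xs + 1 + length ys = 2" for xs ys
    using L that unfolding multilinear_form_def by blast
  show ?R using *[of "[]" "[_]"] *[of "[_]" "[]"] by simp
next
  assume R: ?R
  show ?L unfolding multilinear_form_def
  proof (intro allI impI)
    fix xs ys :: "'a list" assume l: "length xs + 1 + length ys = 2"
    then consider y where "xs = []" "ys = [y]" | x where "xs = [x]" "ys = []"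
      by (cases xs; cases ys) auto
    then show "linear_form s (\<lambda>x. T (xs @ [x] @ ys))" using R by cases simp_all
  qed
qed

lemma multilinear_form_3:
  fixes s :: "'k::field \<Rightarrow> 'a::ab_group_add \<Rightarrow> 'a"
  shows "multilinear_form s 3 T \<longleftrightarrow>
    (\<forall>y z. linear_form s (\<lambda>x. T [x, y, z])) \<and> (\<forall>x z. linear_form s (\<lambda>y. T [x, y, z])) \<and>
    (\<forall>x y. linear_form s (\<lambda>z. T [x, y, z]))"
  (is "?L \<longleftrightarrow> ?R")
proof
  assume L: ?L
  have *: "linear_form s (\<lambda>x. T (xs @ [x] @ ys))" if "length xs + 1 + length ys = 3" for xs ys
    using L that unfolding multilinear_form_def by blast
  show ?R using *[of "[]" "[_, _]"] *[of "[_]" "[_]"] *[of "[_, _]" "[]"] by simp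
next
  assume R: ?R
  show ?L unfolding multilinear_form_def
  proof (intro allI impI)
    fix xs ys :: "'a list" assume l: "length xs + 1 + length ys = 3"
    then consider y z where "xs = []" "ys = [y, z]" | x y where "xs = [x]" "ys = [y]"
      | x y where "xs = [x, y]" "ys = []"
      by (cases xs; cases ys; cases "tl xs"; cases "tl ys") auto
    then show "linear_form s (\<lambda>x. T (xs @ [x] @ ys))" using R by cases simp_all
  qed
qed

lemma multilinear_form_appendL:
  fixes s :: "'k::field \<Rightarrow> 'a::ab_group_add \<Rightarrow> 'a"
  assumes "multilinear_form s (m + n) T" "length v = m"
  shows "multilinear_form s n (\<lambda>w. T (v @ w))"
  unfolding multilinear_form_def
proof (intro allI impI)
  fix xs ys :: "'a list" assume "length xs + 1 + length ys = n"
  then have "length (v @ xs) + 1 + length ys = m + n" using assms(2) by simp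
  then have "linear_form s (\<lambda>x. T ((v @ xs) @ [x] @ ys))"
    using assms(1) unfolding multilinear_form_def by blast
  then show "linear_form s (\<lambda>x. T (v @ xs @ [x] @ ys))" by simp
qed

lemma multilinear_form_appendR:
  fixes s :: "'k::field \<Rightarrow> 'a::ab_group_add \<Rightarrow> 'a"
  assumes "multilinear_form s (m + n) T" "length w = n"
  shows "multilinear_form s m (\<lambda>v. T (v @ w))"
  unfolding multilinear_form_def
proof (intro allI impI)
  fix xs ys :: "'a list" assume "length xs + 1 + length ys = m"
  then have "length xs + 1 + length (ys @ w) = m + n" using assms(2) by simp
  then have "linear_form s (\<lambda>x. T (xs @ [x] @ (ys @ w)))"
    using assms(1) unfolding multilinear_form_def by blast
  then show "linear_form s (\<lambda>x. T ((xs @ [x] @ ys) @ w))" by simp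
qed

lemma linear_form_tensor_eval:
  assumes "Y \<in> tensor_power s n" "\<And>w. length w = n \<Longrightarrow> linear_form s (\<lambda>x. F x w)"
  shows "linear_form s (\<lambda>x. tensor_eval (F x) Y)"
proof -
  have "tensor_eval (F (x + y)) Y = tensor_eval (\<lambda>w. F x w + F y w) Y"
    and "tensor_eval (F (s c x)) Y = tensor_eval (\<lambda>w. c * F x w) Y" for x y c
    using assms(2) by (intro tensor_eval_cong[OF assms(1)]; simp add: linear_form_def)+
  then show ?thesis
    by (simp add: linear_form_def tensor_eval_plus tensor_eval_times)
qed

text \<open>A linear combination of multilinear forms is multilinear; here the coefficients come
  from the terms of \<open>Y\<close>.\<close>

lemma multilinear_form_tensor_eval:
  assumes "Y \<in> tensor_power s n" "\<And>w. length w = n \<Longrightarrow> multilinear_form s m (\<lambda>v. F v w)"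
  shows "multilinear_form s m (\<lambda>v. tensor_eval (F v) Y)"
  using assms(2) unfolding multilinear_form_def
  by (intro allI impI linear_form_tensor_eval[OF assms(1)]) blast

text \<open>Each nested lift in \<open>tensor_concat\<close> becomes a sum: the inner one over the
  terms of \<open>Y\<close> for a fixed word \<open>v\<close>, then the outer one over the terms of
  \<open>X\<close>.\<close>

lemma
  assumes X: "X \<in> tensor_power s m" and Y: "Y \<in> tensor_power s n"
  shows tensor_concat_in: "tensor_concat s m n X Y \<in> tensor_power s (m + n)"
    and tensor_eval_concat: "multilinear_form s (m + n) T \<Longrightarrow>
      tensor_eval T (tensor_concat s m n X Y) = tensor_eval (\<lambda>v. tensor_eval (\<lambda>w. T (v @ w)) Y) X"
proof -
  have inner: "tensor_lift s (m + n) (\<lambda>w. pure_tensor s (v @ w)) Y \<in> tensor_power s (m + n)"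
    if "length v = m" for v
    using that by (intro tensor_lift_in[OF Y] pure_tensor_in) simp
  then show "tensor_concat s m n X Y \<in> tensor_power s (m + n)"
    unfolding tensor_concat_def by (rule tensor_lift_in[OF X])
  assume T: "multilinear_form s (m + n) T"
  have "tensor_eval T (tensor_lift s (m + n) (\<lambda>w. pure_tensor s (v @ w)) Y) =
      tensor_eval (\<lambda>w. T (v @ w)) Y" if "length v = m" for v
    using that by (subst tensor_eval_lift[OF T Y])
      (auto intro!: pure_tensor_in tensor_eval_cong[OF Y] tensor_eval_pure[OF T])
  then show "tensor_eval T (tensor_concat s m n X Y) =
      tensor_eval (\<lambda>v. tensor_eval (\<lambda>w. T (v @ w)) Y) X"
    unfolding tensor_concat_def
    by (subst tensor_eval_lift[OF T X inner]) (auto intro: tensor_eval_cong[OF X])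
qed


section \<open>The coboundary comultiplication\<close>

locale hom_associative_tensor =
  fixes s :: "'k::field \<Rightarrow> 'a::ab_group_add \<Rightarrow> 'a"
    and \<mu> :: "'a \<Rightarrow> 'a \<Rightarrow> 'a" and \<alpha> :: "'a \<Rightarrow> 'a" and r :: "('a, 'k) tensor"
  assumes hom_associative: "hom_associative s \<mu> \<alpha>"
    and r_in: "r \<in> tensor_power s 2"
    and r_invariant: "alpha_invariant s \<alpha> r"
begin

section \<open>Structure maps, and sums over the terms of \<open>r\<close>\<close>

lemma mu_left: "Vector_Spaces.linear s s (\<mu> x)"
  and mu_right: "Vector_Spaces.linear s s (\<lambda>x. \<mu> x y)"
  and linear_alpha: "Vector_Spaces.linear s s \<alpha>"
  using hom_associative by (auto simp: hom_associative_def)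

lemma mu_add_right: "\<mu> x (y + z) = \<mu> x y + \<mu> x z"
  and mu_scale_right: "\<mu> x (s c y) = s c (\<mu> x y)"
  and mu_add_left: "\<mu> (x + y) z = \<mu> x z + \<mu> y z"
  and mu_scale_left: "\<mu> (s c x) z = s c (\<mu> x z)"
  and alpha_add: "\<alpha> (x + y) = \<alpha> x + \<alpha> y"
  and alpha_scale: "\<alpha> (s c x) = s c (\<alpha> x)"
  using mu_left[of x] mu_right[of z] linear_alpha
  by (simp_all add: Vector_Spaces.linear_def module_hom_def module_hom_axioms_def module_hom_iff_linear[symmetric])

lemma alpha_mult: "\<alpha> (\<mu> x y) = \<mu> (\<alpha> x) (\<alpha> y)"
  and hom_assoc: "\<mu> (\<alpha> x) (\<mu> y z) = \<mu> (\<mu> x y) (\<alpha> z)"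
  using hom_associative by (simp_all add: hom_associative_def)

lemmas multiadditive =
  linear_form_def mu_add_right mu_scale_right mu_add_left mu_scale_left alpha_add alpha_scale

text \<open>Stands for the sum of \<open>F u v\<close> over the terms \<open>u \<otimes> v\<close>
  of \<open>r\<close>; nested uses model the double sums over i and j.\<close>

definition r_sum :: "('a \<Rightarrow> 'a \<Rightarrow> 'k) \<Rightarrow> 'k"
  where "r_sum F = tensor_eval (\<lambda>w. F (w ! 0) (w ! 1)) r"

lemma r_sum_add: "r_sum (\<lambda>u v. F u v + G u v) = r_sum F + r_sum G"
  and r_sum_diff: "r_sum (\<lambda>u v. F u v - G u v) = r_sum F - r_sum G"
  and r_sum_mult: "r_sum (\<lambda>u v. c * F u v) = c * r_sum F"
  by (simp_all add: r_sum_def tensor_eval_plus tensor_eval_minus tensor_eval_times)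

lemma r_sum_swap:
  "r_sum (\<lambda>u v. r_sum (\<lambda>u' v'. F u v u' v')) = r_sum (\<lambda>u' v'. r_sum (\<lambda>u v. F u v u' v'))"
  unfolding r_sum_def by (rule tensor_eval_swap)

lemma linear_form_r_sum:
  "(\<And>u v. linear_form s (\<lambda>x. F x u v)) \<Longrightarrow> linear_form s (\<lambda>x. r_sum (F x))"
  unfolding r_sum_def by (rule linear_form_tensor_eval[OF r_in])

lemma length_3_eq: "length w = 3 \<Longrightarrow> w = [w ! 0, w ! 1, w ! 2]"
  by (auto simp: numeral_3_eq_3 numeral_2_eq_2 length_Suc_conv)

text \<open>The two sides sum over two formal expressions of the same tensor, \<open>r\<close> and
  its image under \<alpha> \<otimes> \<alpha>. Bilinearity of \<open>F\<close> makes the sums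
  agree.\<close>

lemma r_sum_alpha:
  assumes "\<And>v. linear_form s (\<lambda>u. F u v)" "\<And>u. linear_form s (F u)"
  shows "r_sum (\<lambda>u v. F (\<alpha> u) (\<alpha> v)) = r_sum F"
proof -
  let ?T = "\<lambda>w. F (w ! 0) (w ! 1)"
  have T: "multilinear_form s 2 ?T" using assms by (simp add: multilinear_form_2)
  have "r_sum F = tensor_eval ?T (alpha_alpha s \<alpha> r)"
    using r_invariant by (simp add: alpha_invariant_def r_sum_def)
  also have "\<dots> = r_sum (\<lambda>u v. F (\<alpha> u) (\<alpha> v))"
    unfolding alpha_alpha_def r_sum_def
    by (subst tensor_eval_lift[OF T r_in]) (simp_all add: pure_tensor_in tensor_eval_pure[OF T] del: One_nat_def)
  finally show ?thesis by simp
qed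

section \<open>The comultiplication and the maps built from it\<close>

abbreviation Delta :: "'a \<Rightarrow> ('a, 'k) tensor"
  where "Delta a \<equiv> star_bracket s \<mu> \<alpha> a r"

lemma Delta_in: "Delta a \<in> tensor_power s 2"
  unfolding star_bracket_def Let_def
  by (intro tensor_lift_in[OF r_in] tensor_diff_in pure_tensor_in) simp_all

lemma tensor_eval_Delta:
  assumes T: "multilinear_form s 2 T"
  shows "tensor_eval T (Delta a) = r_sum (\<lambda>u v. T [\<mu> a u, \<alpha> v] - T [\<alpha> u, \<mu> v a])"
  unfolding star_bracket_def Let_def r_sum_def
  by (subst tensor_eval_lift[OF T r_in])
    (simp_all add: tensor_diff_in pure_tensor_in tensor_eval_diff[OF T] tensor_eval_pure[OF T])

lemma alpha_alpha_in: "X \<in> tensor_power s 2 \<Longrightarrow> alpha_alpha s \<alpha> X \<in> tensor_power s 2"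
  and alpha_mu_in: "Y \<in> tensor_power s 3 \<Longrightarrow> alpha_mu s \<mu> \<alpha> Y \<in> tensor_power s 2"
  and mu_alpha_in: "Y \<in> tensor_power s 3 \<Longrightarrow> mu_alpha s \<mu> \<alpha> Y \<in> tensor_power s 2"
  unfolding alpha_alpha_def alpha_mu_def mu_alpha_def
  by (erule tensor_lift_in, simp add: pure_tensor_in)+

lemma
  assumes T: "multilinear_form s 2 T"
  shows tensor_eval_alpha_alpha: "X \<in> tensor_power s 2 \<Longrightarrow>
      tensor_eval T (alpha_alpha s \<alpha> X) = tensor_eval (\<lambda>w. T [\<alpha> (w ! 0), \<alpha> (w ! 1)]) X"
    and tensor_eval_alpha_mu: "Y \<in> tensor_power s 3 \<Longrightarrow>
      tensor_eval T (alpha_mu s \<mu> \<alpha> Y) = tensor_eval (\<lambda>w. T [\<alpha> (w ! 0), \<mu> (w ! 1) (w ! 2)]) Y"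
    and tensor_eval_mu_alpha: "Y \<in> tensor_power s 3 \<Longrightarrow>
      tensor_eval T (mu_alpha s \<mu> \<alpha> Y) = tensor_eval (\<lambda>w. T [\<mu> (w ! 0) (w ! 1), \<alpha> (w ! 2)]) Y"
  unfolding alpha_alpha_def alpha_mu_def mu_alpha_def
  by (simp_all add: tensor_eval_lift[OF T] pure_tensor_in tensor_eval_pure[OF T])

lemma concat_alpha_Delta_in: "tensor_concat s 1 2 (pure_tensor s [x]) (Delta y) \<in> tensor_power s 3"
  and concat_Delta_alpha_in: "tensor_concat s 2 1 (Delta y) (pure_tensor s [x]) \<in> tensor_power s 3"
  using tensor_concat_in[OF pure_tensor_in[of "[x]" 1] Delta_in[of y]]
    tensor_concat_in[OF Delta_in[of y] pure_tensor_in[of "[x]" 1]]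
  by (simp_all del: One_nat_def)

lemma alpha_Delta_in: "X \<in> tensor_power s 2 \<Longrightarrow> alpha_Delta s \<alpha> Delta X \<in> tensor_power s 3"
  and Delta_alpha_in: "X \<in> tensor_power s 2 \<Longrightarrow> Delta_alpha s \<alpha> Delta X \<in> tensor_power s 3"
  unfolding alpha_Delta_def Delta_alpha_def
  by (erule tensor_lift_in, rule concat_alpha_Delta_in concat_Delta_alpha_in)+

lemma
  assumes T: "multilinear_form s 3 T"
  shows tensor_eval_concat_alpha_Delta:
      "tensor_eval T (tensor_concat s 1 2 (pure_tensor s [x]) (Delta y)) =
        r_sum (\<lambda>u v. T [x, \<mu> y u, \<alpha> v] - T [x, \<alpha> u, \<mu> v y])"
    and tensor_eval_concat_Delta_alpha:
      "tensor_eval T (tensor_concat s 2 1 (Delta y) (pure_tensor s [x])) =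
        r_sum (\<lambda>u v. T [\<mu> y u, \<alpha> v, x] - T [\<alpha> u, \<mu> v y, x])"
proof -
  have T12: "multilinear_form s (1 + 2) T" and T21: "multilinear_form s (2 + 1) T"
    using T by (simp_all del: One_nat_def)
  have p: "pure_tensor s [x] \<in> tensor_power s 1" by (simp add: pure_tensor_in)
  show "tensor_eval T (tensor_concat s 1 2 (pure_tensor s [x]) (Delta y)) =
      r_sum (\<lambda>u v. T [x, \<mu> y u, \<alpha> v] - T [x, \<alpha> u, \<mu> v y])"
    unfolding tensor_eval_concat[OF p Delta_in T12]
    using multilinear_form_appendL[OF T12, of "[x]"]
    \<comment> \<open>The outer evaluation is at the pure tensor of \<open>x\<close>, so what
      remains after summing over the terms of \<open>Delta y\<close> must be linear in that one
      letter.\<close>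
    by (subst tensor_eval_pure[OF multilinear_form_tensor_eval[OF Delta_in multilinear_form_appendR[OF T12]]])
      (simp_all add: tensor_eval_Delta)
  have "tensor_eval (\<lambda>w. T (v @ w)) (pure_tensor s [x]) = T (v @ [x])" if "length v = 2" for v
    by (rule tensor_eval_pure[OF multilinear_form_appendL[OF T21 that]]) simp
  then show "tensor_eval T (tensor_concat s 2 1 (Delta y) (pure_tensor s [x])) =
      r_sum (\<lambda>u v. T [\<mu> y u, \<alpha> v, x] - T [\<alpha> u, \<mu> v y, x])"
    unfolding tensor_eval_concat[OF Delta_in p T21]
    using multilinear_form_appendR[OF T21, of "[x]"]
    by (subst tensor_eval_cong[OF Delta_in, of _ "\<lambda>v. T (v @ [x])"]) (simp_all add: tensor_eval_Delta)
qed

lemma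
  assumes T: "multilinear_form s 3 T" and X: "X \<in> tensor_power s 2"
  shows tensor_eval_alpha_Delta: "tensor_eval T (alpha_Delta s \<alpha> Delta X) =
      tensor_eval (\<lambda>w. r_sum (\<lambda>u v.
        T [\<alpha> (w ! 0), \<mu> (w ! 1) u, \<alpha> v] - T [\<alpha> (w ! 0), \<alpha> u, \<mu> v (w ! 1)])) X"
    and tensor_eval_Delta_alpha: "tensor_eval T (Delta_alpha s \<alpha> Delta X) =
      tensor_eval (\<lambda>w. r_sum (\<lambda>u v.
        T [\<mu> (w ! 0) u, \<alpha> v, \<alpha> (w ! 1)] - T [\<alpha> u, \<mu> v (w ! 0), \<alpha> (w ! 1)])) X"
  unfolding alpha_Delta_def Delta_alpha_def
    tensor_eval_lift[OF T X concat_alpha_Delta_in] tensor_eval_lift[OF T X concat_Delta_alpha_in]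
    tensor_eval_concat_alpha_Delta[OF T] tensor_eval_concat_Delta_alpha[OF T]
  by (rule refl)+

section \<open>The axioms that hold for every invariant \<open>r\<close>\<close>

lemma Delta_add: "Delta (a + b) = tensor_add s 2 (Delta a) (Delta b)"
proof (rule tensor_eqI[OF Delta_in tensor_add_in[OF Delta_in Delta_in]])
  fix T assume T: "multilinear_form s 2 T"
  then have "tensor_eval T (Delta (a + b)) = r_sum (\<lambda>u v.
      (T [\<mu> a u, \<alpha> v] - T [\<alpha> u, \<mu> v a]) + (T [\<mu> b u, \<alpha> v] - T [\<alpha> u, \<mu> v b]))"
    by (simp add: tensor_eval_Delta multilinear_form_2 multiadditive algebra_simps)
  then show "tensor_eval T (Delta (a + b)) = tensor_eval T (tensor_add s 2 (Delta a) (Delta b))"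
    using T by (simp only: r_sum_add tensor_eval_Delta tensor_eval_add Delta_in)
qed

lemma Delta_scale: "Delta (s c a) = tensor_scale s 2 c (Delta a)"
proof (rule tensor_eqI[OF Delta_in tensor_scale_in[OF Delta_in]])
  fix T assume T: "multilinear_form s 2 T"
  then have "tensor_eval T (Delta (s c a)) = r_sum (\<lambda>u v. c * (T [\<mu> a u, \<alpha> v] - T [\<alpha> u, \<mu> v a]))"
    by (simp add: tensor_eval_Delta multilinear_form_2 multiadditive algebra_simps)
  then show "tensor_eval T (Delta (s c a)) = tensor_eval T (tensor_scale s 2 c (Delta a))"
    using T by (simp only: r_sum_mult tensor_eval_Delta tensor_eval_scale Delta_in)
qed

lemma alpha_alpha_Delta: "alpha_alpha s \<alpha> (Delta a) = Delta (\<alpha> a)"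
proof (rule tensor_eqI[OF alpha_alpha_in[OF Delta_in] Delta_in])
  fix T assume T: "multilinear_form s 2 T"
  then have T': "multilinear_form s 2 (\<lambda>w. T [\<alpha> (w ! 0), \<alpha> (w ! 1)])"
    by (simp add: multilinear_form_2 multiadditive)
  have "tensor_eval T (alpha_alpha s \<alpha> (Delta a)) =
      r_sum (\<lambda>u v. T [\<mu> (\<alpha> a) (\<alpha> u), \<alpha> (\<alpha> v)] - T [\<alpha> (\<alpha> u), \<mu> (\<alpha> v) (\<alpha> a)])"
    by (simp add: tensor_eval_alpha_alpha[OF T Delta_in] tensor_eval_Delta[OF T'] alpha_mult del: One_nat_def)
  \<comment> \<open>The surplus \<alpha> on both \<open>u\<close> and \<open>v\<close> is absorbed
    by the invariance of \<open>r\<close>.\<close>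
  also have "\<dots> = r_sum (\<lambda>u v. T [\<mu> (\<alpha> a) u, \<alpha> v] - T [\<alpha> u, \<mu> v (\<alpha> a)])"
    by (rule r_sum_alpha) (use T in \<open>simp_all add: multilinear_form_2 multiadditive algebra_simps\<close>)
  finally show "tensor_eval T (alpha_alpha s \<alpha> (Delta a)) = tensor_eval T (Delta (\<alpha> a))"
    by (simp add: tensor_eval_Delta[OF T])
qed

lemma Delta_mu:
  "Delta (\<mu> a b) = tensor_add s 2
     (mu_alpha s \<mu> \<alpha> (alpha_Delta s \<alpha> Delta (pure_tensor s [a, b])))
     (alpha_mu s \<mu> \<alpha> (Delta_alpha s \<alpha> Delta (pure_tensor s [a, b])))"
proof (rule tensor_eqI[OF Delta_in])
  have p: "pure_tensor s [a, b] \<in> tensor_power s 2" by (simp add: pure_tensor_in)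
  note in3 = alpha_Delta_in[OF p] Delta_alpha_in[OF p]
  note in2 = mu_alpha_in[OF in3(1)] alpha_mu_in[OF in3(2)]
  show "tensor_add s 2
     (mu_alpha s \<mu> \<alpha> (alpha_Delta s \<alpha> Delta (pure_tensor s [a, b])))
     (alpha_mu s \<mu> \<alpha> (Delta_alpha s \<alpha> Delta (pure_tensor s [a, b]))) \<in> tensor_power s 2"
    by (rule tensor_add_in[OF in2])
  fix T assume T: "multilinear_form s 2 T"
  have T1: "multilinear_form s 3 (\<lambda>w. T [\<mu> (w ! 0) (w ! 1), \<alpha> (w ! 2)])"
    and T2: "multilinear_form s 3 (\<lambda>w. T [\<alpha> (w ! 0), \<mu> (w ! 1) (w ! 2)])"
    using T by (simp_all add: multilinear_form_2 multilinear_form_3 multiadditive)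
  \<comment> \<open>Bilinearity in the two letters allows evaluation at the pure tensor of
    \<open>a\<close> and \<open>b\<close>.\<close>
  have F1: "multilinear_form s 2 (\<lambda>w. r_sum (\<lambda>u v.
        T [\<mu> (\<alpha> (w ! 0)) (\<mu> (w ! 1) u), \<alpha> (\<alpha> v)] - T [\<mu> (\<alpha> (w ! 0)) (\<alpha> u), \<alpha> (\<mu> v (w ! 1))]))"
    and F2: "multilinear_form s 2 (\<lambda>w. r_sum (\<lambda>u v.
        T [\<alpha> (\<mu> (w ! 0) u), \<mu> (\<alpha> v) (\<alpha> (w ! 1))] - T [\<alpha> (\<alpha> u), \<mu> (\<mu> v (w ! 0)) (\<alpha> (w ! 1))]))"
    unfolding multilinear_form_2
    by (intro conjI allI linear_form_r_sum;
      use T in \<open>simp add: multilinear_form_2 multiadditive algebra_simps\<close>)+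
  have "tensor_eval T (tensor_add s 2
     (mu_alpha s \<mu> \<alpha> (alpha_Delta s \<alpha> Delta (pure_tensor s [a, b])))
     (alpha_mu s \<mu> \<alpha> (Delta_alpha s \<alpha> Delta (pure_tensor s [a, b])))) =
    r_sum (\<lambda>u v. T [\<mu> (\<alpha> a) (\<mu> b u), \<alpha> (\<alpha> v)] - T [\<mu> (\<alpha> a) (\<alpha> u), \<alpha> (\<mu> v b)]) +
    r_sum (\<lambda>u v. T [\<alpha> (\<mu> a u), \<mu> (\<alpha> v) (\<alpha> b)] - T [\<alpha> (\<alpha> u), \<mu> (\<mu> v a) (\<alpha> b)])"
    unfolding tensor_eval_add[OF T in2] tensor_eval_mu_alpha[OF T in3(1)]
      tensor_eval_alpha_mu[OF T in3(2)] tensor_eval_alpha_Delta[OF T1 p] tensor_eval_Delta_alpha[OF T2 p]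
    using tensor_eval_pure[OF F1, of "[a, b]"] tensor_eval_pure[OF F2, of "[a, b]"] by simp
  \<comment> \<open>The two mixed terms, with \<open>a\<close> in the first slot and
    \<open>b\<close> in the second, cancel because \<alpha> is multiplicative; Hom-associativity
    collects \<open>\<mu> a b\<close> in the other two.\<close>
  also have "\<dots> = r_sum (\<lambda>u v.
      T [\<mu> (\<mu> a b) (\<alpha> u), \<alpha> (\<alpha> v)] - T [\<alpha> (\<alpha> u), \<mu> (\<alpha> v) (\<mu> a b)])"
    unfolding r_sum_add[symmetric] by (simp add: alpha_mult hom_assoc)
  also have "\<dots> = r_sum (\<lambda>u v. T [\<mu> (\<mu> a b) u, \<alpha> v] - T [\<alpha> u, \<mu> v (\<mu> a b)])"
    by (rule r_sum_alpha) (use T in \<open>simp_all add: multilinear_form_2 multiadditive algebra_simps\<close>)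
  finally show "tensor_eval T (Delta (\<mu> a b)) = tensor_eval T (tensor_add s 2
     (mu_alpha s \<mu> \<alpha> (alpha_Delta s \<alpha> Delta (pure_tensor s [a, b])))
     (alpha_mu s \<mu> \<alpha> (Delta_alpha s \<alpha> Delta (pure_tensor s [a, b]))))"
    by (simp add: tensor_eval_Delta[OF T])
qed

section \<open>The element A(r), its bullet bracket and coassociativity\<close>

lemma A_elem_inner_in:
  "tensor_lift s 3
    (\<lambda>w'. let ui = w ! 0; vi = w ! 1; uj = w' ! 0; vj = w' ! 1 in
      tensor_add s 3
        (tensor_diff s 3 (pure_tensor s [\<mu> ui uj, \<alpha> vj, \<alpha> vi]) (pure_tensor s [\<alpha> ui, \<mu> vi uj, \<alpha> vj]))
        (pure_tensor s [\<alpha> uj, \<alpha> ui, \<mu> vi vj])) r \<in> tensor_power s 3"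
  unfolding Let_def
  by (intro tensor_lift_in[OF r_in] tensor_add_in tensor_diff_in pure_tensor_in) simp_all

lemma A_elem_in: "A_elem s \<mu> \<alpha> r \<in> tensor_power s 3"
  unfolding A_elem_def by (intro tensor_lift_in[OF r_in] A_elem_inner_in)

text \<open>\<open>u\<close>, \<open>v\<close> carry the index i and \<open>u'\<close>,
  \<open>v'\<close> the index j of the double sums in A(r).\<close>

lemma tensor_eval_A_elem:
  assumes T: "multilinear_form s 3 T"
  shows "tensor_eval T (A_elem s \<mu> \<alpha> r) = r_sum (\<lambda>u v. r_sum (\<lambda>u' v'.
    T [\<mu> u u', \<alpha> v', \<alpha> v] - T [\<alpha> u, \<mu> v u', \<alpha> v'] + T [\<alpha> u', \<alpha> u, \<mu> v v']))"
  unfolding A_elem_def tensor_eval_lift[OF T r_in A_elem_inner_in] unfolding r_sum_def Let_def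
  by (simp add: tensor_eval_lift[OF T r_in] tensor_add_in tensor_diff_in pure_tensor_in
      tensor_eval_add[OF T] tensor_eval_diff[OF T] tensor_eval_pure[OF T])

lemma bullet_bracket_in:
  assumes "X \<in> tensor_power s 3"
  shows "bullet_bracket s \<mu> \<alpha> 3 a X \<in> tensor_power s 3"
  unfolding bullet_bracket_def
  by (intro tensor_lift_in[OF assms] tensor_diff_in pure_tensor_in) simp_all

lemma tensor_eval_bullet_bracket:
  assumes T: "multilinear_form s 3 T" and X: "X \<in> tensor_power s 3"
  shows "tensor_eval T (bullet_bracket s \<mu> \<alpha> 3 a X) = tensor_eval (\<lambda>w.
    T [\<mu> (\<alpha> a) (w ! 0), \<alpha> (w ! 1), \<alpha> (w ! 2)] - T [\<alpha> (w ! 0), \<alpha> (w ! 1), \<mu> (w ! 2) (\<alpha> a)]) X"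
  unfolding bullet_bracket_def
proof (subst tensor_eval_lift[OF T X])
  show "tensor_diff s 3 (pure_tensor s (\<mu> (\<alpha> a) (hd w) # map \<alpha> (tl w)))
      (pure_tensor s (map \<alpha> (butlast w) @ [\<mu> (last w) (\<alpha> a)])) \<in> tensor_power s 3"
    if "length w = 3" for w
    using that by (intro tensor_diff_in pure_tensor_in) simp_all
  show "tensor_eval (\<lambda>w. tensor_eval T (tensor_diff s 3
        (pure_tensor s (\<mu> (\<alpha> a) (hd w) # map \<alpha> (tl w)))
        (pure_tensor s (map \<alpha> (butlast w) @ [\<mu> (last w) (\<alpha> a)])))) X =
      tensor_eval (\<lambda>w. T [\<mu> (\<alpha> a) (w ! 0), \<alpha> (w ! 1), \<alpha> (w ! 2)] -
        T [\<alpha> (w ! 0), \<alpha> (w ! 1), \<mu> (w ! 2) (\<alpha> a)]) X"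
  proof (rule tensor_eval_cong[OF X])
    fix w :: "'a list" assume "length w = 3"
    \<comment> \<open>Naming the letters lets \<open>hd\<close>, \<open>tl\<close>,
      \<open>butlast\<close> and \<open>last\<close> be computed.\<close>
    then obtain x y z where "w = [x, y, z]" using length_3_eq by blast
    then show "tensor_eval T (tensor_diff s 3
        (pure_tensor s (\<mu> (\<alpha> a) (hd w) # map \<alpha> (tl w)))
        (pure_tensor s (map \<alpha> (butlast w) @ [\<mu> (last w) (\<alpha> a)]))) =
      T [\<mu> (\<alpha> a) (w ! 0), \<alpha> (w ! 1), \<alpha> (w ! 2)] - T [\<alpha> (w ! 0), \<alpha> (w ! 1), \<mu> (w ! 2) (\<alpha> a)]"
      by (simp add: tensor_eval_diff[OF T] tensor_eval_pure[OF T] pure_tensor_in)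
  qed
qed

text \<open>The left side has eight double sums. The two with \<open>a\<close> in the middle slot
  cancel by Hom-associativity after renaming the summation indices; the other six are, up to sign,
  the six terms of the bullet bracket.\<close>

lemma coassociator_eq:
  assumes T: "multilinear_form s 3 T"
  shows "tensor_eval T (alpha_Delta s \<alpha> Delta (Delta a)) - tensor_eval T (Delta_alpha s \<alpha> Delta (Delta a))
    = - tensor_eval T (bullet_bracket s \<mu> \<alpha> 3 a (A_elem s \<mu> \<alpha> r))"
proof -
  note T3 = T[unfolded multilinear_form_3]
  \<comment> \<open>The sums created by the second application of \<open>Delta\<close>, as bilinear
    forms to be evaluated at \<open>Delta a\<close>.\<close>
  have F1: "multilinear_form s 2 (\<lambda>w. r_sum (\<lambda>u v.
        T [\<alpha> (w ! 0), \<mu> (w ! 1) u, \<alpha> v] - T [\<alpha> (w ! 0), \<alpha> u, \<mu> v (w ! 1)]))"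
    and F2: "multilinear_form s 2 (\<lambda>w. r_sum (\<lambda>u v.
        T [\<mu> (w ! 0) u, \<alpha> v, \<alpha> (w ! 1)] - T [\<alpha> u, \<mu> v (w ! 0), \<alpha> (w ! 1)]))"
    unfolding multilinear_form_2
    by (intro conjI allI linear_form_r_sum; use T3 in \<open>simp add: multiadditive algebra_simps\<close>)+
  \<comment> \<open>The form \<open>T\<close> pulled back along the bullet bracket with
    \<open>a\<close>, to be evaluated at A(r).\<close>
  have G: "multilinear_form s 3 (\<lambda>w.
    T [\<mu> (\<alpha> a) (w ! 0), \<alpha> (w ! 1), \<alpha> (w ! 2)] - T [\<alpha> (w ! 0), \<alpha> (w ! 1), \<mu> (w ! 2) (\<alpha> a)])"
    unfolding multilinear_form_3
    by (intro conjI allI; use T3 in \<open>simp add: multiadditive algebra_simps\<close>)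
  have 1: "tensor_eval T (alpha_Delta s \<alpha> Delta (Delta a)) = r_sum (\<lambda>u v.
      r_sum (\<lambda>u' v'. T [\<alpha> (\<mu> a u), \<mu> (\<alpha> v) u', \<alpha> v'] - T [\<alpha> (\<mu> a u), \<alpha> u', \<mu> v' (\<alpha> v)]
        - (T [\<alpha> (\<alpha> u), \<mu> (\<mu> v a) u', \<alpha> v'] - T [\<alpha> (\<alpha> u), \<alpha> u', \<mu> v' (\<mu> v a)])))"
    unfolding tensor_eval_alpha_Delta[OF T Delta_in] tensor_eval_Delta[OF F1]
    by (simp add: r_sum_diff)
  have 2: "tensor_eval T (Delta_alpha s \<alpha> Delta (Delta a)) = r_sum (\<lambda>u v.
      r_sum (\<lambda>u' v'. T [\<mu> (\<mu> a u) u', \<alpha> v', \<alpha> (\<alpha> v)] - T [\<alpha> u', \<mu> v' (\<mu> a u), \<alpha> (\<alpha> v)]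
        - (T [\<mu> (\<alpha> u) u', \<alpha> v', \<alpha> (\<mu> v a)] - T [\<alpha> u', \<mu> v' (\<alpha> u), \<alpha> (\<mu> v a)])))"
    unfolding tensor_eval_Delta_alpha[OF T Delta_in] tensor_eval_Delta[OF F2]
    by (simp add: r_sum_diff)
  have 3: "tensor_eval T (bullet_bracket s \<mu> \<alpha> 3 a (A_elem s \<mu> \<alpha> r)) = r_sum (\<lambda>u v. r_sum (\<lambda>u' v'.
      T [\<mu> (\<alpha> a) (\<mu> u u'), \<alpha> (\<alpha> v'), \<alpha> (\<alpha> v)] - T [\<alpha> (\<mu> u u'), \<alpha> (\<alpha> v'), \<mu> (\<alpha> v) (\<alpha> a)]
      - (T [\<mu> (\<alpha> a) (\<alpha> u), \<alpha> (\<mu> v u'), \<alpha> (\<alpha> v')] - T [\<alpha> (\<alpha> u), \<alpha> (\<mu> v u'), \<mu> (\<alpha> v') (\<alpha> a)])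
      + (T [\<mu> (\<alpha> a) (\<alpha> u'), \<alpha> (\<alpha> u), \<alpha> (\<mu> v v')] - T [\<alpha> (\<alpha> u'), \<alpha> (\<alpha> u), \<mu> (\<mu> v v') (\<alpha> a)])))"
    unfolding tensor_eval_bullet_bracket[OF T A_elem_in] tensor_eval_A_elem[OF G] by simp
  \<comment> \<open>The inner \<open>u'\<close>, \<open>v'\<close> have passed through one map fewer
    than \<open>u\<close>, \<open>v\<close>. Invariance of \<open>r\<close> supplies the missing
    \<alpha>, as \<open>hom_assoc\<close> and \<open>alpha_mult\<close> require.\<close>
  have 4: "tensor_eval T (alpha_Delta s \<alpha> Delta (Delta a)) = r_sum (\<lambda>u v. r_sum (\<lambda>u' v'.
      T [\<alpha> (\<mu> a u), \<mu> (\<alpha> v) (\<alpha> u'), \<alpha> (\<alpha> v')] - T [\<alpha> (\<mu> a u), \<alpha> (\<alpha> u'), \<mu> (\<alpha> v') (\<alpha> v)]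
        - (T [\<alpha> (\<alpha> u), \<mu> (\<mu> v a) (\<alpha> u'), \<alpha> (\<alpha> v')] - T [\<alpha> (\<alpha> u), \<alpha> (\<alpha> u'), \<mu> (\<alpha> v') (\<mu> v a)])))"
    unfolding 1
    by (rule arg_cong[where f = r_sum], intro ext, rule r_sum_alpha[symmetric])
      (use T3 in \<open>simp_all add: multiadditive algebra_simps\<close>)
  have 5: "tensor_eval T (Delta_alpha s \<alpha> Delta (Delta a)) = r_sum (\<lambda>u v. r_sum (\<lambda>u' v'.
      T [\<mu> (\<mu> a u) (\<alpha> u'), \<alpha> (\<alpha> v'), \<alpha> (\<alpha> v)] - T [\<alpha> (\<alpha> u'), \<mu> (\<alpha> v') (\<mu> a u), \<alpha> (\<alpha> v)]
        - (T [\<mu> (\<alpha> u) (\<alpha> u'), \<alpha> (\<alpha> v'), \<alpha> (\<mu> v a)] - T [\<alpha> (\<alpha> u'), \<mu> (\<alpha> v') (\<alpha> u), \<alpha> (\<mu> v a)])))"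
    unfolding 2
    by (rule arg_cong[where f = r_sum], intro ext, rule r_sum_alpha[symmetric])
      (use T3 in \<open>simp_all add: multiadditive algebra_simps\<close>)
  show ?thesis
    unfolding 3 4 5
    \<comment> \<open>Exchanging (u, v) with (u', v') aligns the remaining terms: the first, second
      and fourth instances match terms of the bracket, the third cancels the pair with
      \<open>a\<close> in the middle.\<close>
    using r_sum_swap[of "\<lambda>u v u' v'. T [\<mu> (\<alpha> a) (\<alpha> u'), \<alpha> (\<alpha> u), \<mu> (\<alpha> v) (\<alpha> v')]"]
      r_sum_swap[of "\<lambda>u v u' v'. T [\<alpha> (\<alpha> u'), \<alpha> (\<alpha> u), \<mu> (\<mu> v v') (\<alpha> a)]"]
      r_sum_swap[of "\<lambda>u v u' v'. T [\<alpha> (\<alpha> u'), \<mu> (\<mu> v' a) (\<alpha> u), \<alpha> (\<alpha> v)]"]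
      r_sum_swap[of "\<lambda>u v u' v'. T [\<alpha> (\<alpha> u'), \<mu> (\<alpha> v') (\<alpha> u), \<mu> (\<alpha> v) (\<alpha> a)]"]
    by (simp add: r_sum_add r_sum_diff alpha_mult hom_assoc)
qed

text \<open>By \<open>coassociator_eq\<close>, a form takes equal values on the two sides of
  coassociativity exactly when it vanishes on the bracket; separation by forms turns this into the
  equivalence, for each \<open>a\<close> separately.\<close>

lemma coassociative_iff:
  "alpha_Delta s \<alpha> Delta (Delta a) = Delta_alpha s \<alpha> Delta (Delta a) \<longleftrightarrow>
    bullet_bracket s \<mu> \<alpha> 3 a (A_elem s \<mu> \<alpha> r) = tensor_zero s 3"
  (is "?L = ?R \<longleftrightarrow> ?B = _")
proof
  assume eq: "?L = ?R"
  show "?B = tensor_zero s 3"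
  proof (rule tensor_eqI[OF bullet_bracket_in[OF A_elem_in] tensor_zero_in])
    fix T assume T: "multilinear_form s 3 T"
    show "tensor_eval T ?B = tensor_eval T (tensor_zero s 3)"
      using coassociator_eq[OF T, of a] eq by (simp add: tensor_eval_zero[OF T])
  qed
next
  assume eq: "?B = tensor_zero s 3"
  show "?L = ?R"
  proof (rule tensor_eqI[OF alpha_Delta_in[OF Delta_in] Delta_alpha_in[OF Delta_in]])
    fix T assume T: "multilinear_form s 3 T"
    show "tensor_eval T ?L = tensor_eval T ?R"
      using coassociator_eq[OF T, of a] eq by (simp add: tensor_eval_zero[OF T])
  qed
qed

end

theorem theorem3p4:
  fixes s :: "'k::field_char_0 \<Rightarrow> 'a::ab_group_add \<Rightarrow> 'a"
    and \<mu> :: "'a \<Rightarrow> 'a \<Rightarrow> 'a"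
    and \<alpha> :: "'a \<Rightarrow> 'a"
    and r :: "('a, 'k) tensor"
    and \<Delta> :: "'a \<Rightarrow> ('a, 'k) tensor"
  assumes "hom_associative s \<mu> \<alpha>"
    and "r \<in> tensor_power s 2"
    and "alpha_invariant s \<alpha> r"
    and "\<Delta> = (\<lambda>a. star_bracket s \<mu> \<alpha> a r)"
  shows "coboundary_eps_hom_bialgebra s \<mu> \<Delta> \<alpha> r \<longleftrightarrow>
    A_invariant s \<mu> \<alpha> 3 (A_elem s \<mu> \<alpha> r)"
proof -
  interpret hom_associative_tensor s \<mu> \<alpha> r
    using assms(1-3) by (rule hom_associative_tensor.intro)
  \<comment> \<open>All axioms but coassociativity are already established, so the equivalence
    reduces to \<open>coassociative_iff\<close> for every \<open>a\<close>.\<close>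
  show ?thesis
    unfolding coboundary_eps_hom_bialgebra_def eps_hom_bialgebra_def A_invariant_def assms(4)
    using assms(1-3) Delta_in Delta_add Delta_scale alpha_alpha_Delta Delta_mu
    by (simp add: coassociative_iff)
qed

end
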